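(* Let $a=x_0<x_1<\cdots<x_{2n}=b$ with $x_{i+1}=x_i+h$ for $i=0,1,\dots,2n-1$ and $h=(b-a)/(2n)$. Suppose that $f\in C^6(x_{j-1},x_{j+1})$ for odd $j$, $1\le j\le 2n-1$. Let $$\bar R_6(f)=\sum_{j=1,\ j\text{ odd}}^{2n-1}\int_{x_{j-1}}^{x_{j+1}}\bar T_{6j}(x)f^{(6)}(x)\,dx,$$ which is the remainder in $$\int_a^bf(x)\,dx=\frac h{15}\sum_{j=1,\ j\text{ odd}}^{2n-1}\left[7f(x_{j-1})+16f(x_j)+7f(x_{j+1})\right]-\frac{h^2}{15}\left[f'(b)-f'(a)\right]+\bar R_6(f).$$ Then $$|\bar R_6(f)|\le\frac12D_6h^6(b-a)\,\|f^{(6)}\|_\infty,$$ where $D_6=2^7C_6$ and $C_6=\frac1{604800}$.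
   Context: The function $f$ is real-valued and $n\ge1$ is an integer. The norm $\|f^{(6)}\|_\infty$ is the supremum of $|f^{(6)}(x)|$ over $x\in[x_{j-1},x_{j+1}]$, taken over all the panels (odd $j$) that enter the sum. For odd $j\in\{1,3,\dots,2n-1\}$ the kernel is $\bar T_{6j}(x)=(2h)^6P_6\left(\frac{x-x_{j-1}}{2h}\right)$ for $x\in[x_{j-1},x_j]$ and $\bar T_{6j}(x)=(2h)^6Q_6\left(\frac{x-x_{j-1}}{2h}\right)$ for $x\in(x_j,x_{j+1}]$, where $P_6(x)=\frac1{6!}x^4(x^2-\frac75x+\frac12)$ and $Q_6(x)=\frac1{6!}(x-1)^4(x^2-\frac35x+\frac1{10})$.
   Formalization: The bound is proved as stated; the formula in which R̄_6 is the remainder fails for f merely C^6 inside the panels (f may jump at x_2), so it is proved for f differentiable on [a,b] (one-sided at a, b) with finite ‖f^(6)‖_∞. *)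

theory Defs
  imports "HOL-Analysis.Analysis"
begin

text \<open>
  Derivatives are taken relative to a set \<open>S\<close>: two-sided at interior points of \<open>S\<close>,
  one-sided at an end point of \<open>S\<close> that belongs to \<open>S\<close>. Where \<^const>\<open>vector_derivative\<close> does not
  exist its value is unspecified, so existence is tracked by \<open>times_differentiable_at\<close>.
\<close>

definition iter_deriv :: "real set \<Rightarrow> nat \<Rightarrow> (real \<Rightarrow> real) \<Rightarrow> real \<Rightarrow> real" where
  "iter_deriv S k f = ((\<lambda>g t. vector_derivative g (at t within S)) ^^ k) f"

definition times_differentiable_at :: "nat \<Rightarrow> real set \<Rightarrow> (real \<Rightarrow> real) \<Rightarrow> real \<Rightarrow> bool" where
  "times_differentiable_at k S f t \<longleftrightarrow>
     (\<forall>i<k. iter_deriv S i f differentiable (at t within S))"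

definition C_on :: "nat \<Rightarrow> real set \<Rightarrow> (real \<Rightarrow> real) \<Rightarrow> bool" where
  "C_on k S f \<longleftrightarrow>
     (\<forall>t\<in>S. times_differentiable_at k S f t) \<and> continuous_on S (iter_deriv S k f)"

definition P6 :: "real \<Rightarrow> real" where
  "P6 t = 1 / fact 6 * t ^ 4 * (t ^ 2 - 7 / 5 * t + 1 / 2)"

definition Q6 :: "real \<Rightarrow> real" where
  "Q6 t = 1 / fact 6 * (t - 1) ^ 4 * (t ^ 2 - 3 / 5 * t + 1 / 10)"

definition C6 :: real where "C6 = 1 / 604800"

definition D6 :: real where "D6 = 2 ^ 7 * C6"

definition odds :: "nat \<Rightarrow> nat set" where
  "odds n = {j. odd j \<and> 1 \<le> j \<and> j \<le> 2 * n - 1}"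

definition panel :: "(nat \<Rightarrow> real) \<Rightarrow> nat \<Rightarrow> real set" where
  "panel x j = {x (j - 1) .. x (j + 1)}"

text \<open>Only the values on \<open>panel x j\<close> matter.\<close>

definition Tbar6 :: "(nat \<Rightarrow> real) \<Rightarrow> real \<Rightarrow> nat \<Rightarrow> real \<Rightarrow> real" where
  "Tbar6 x h j t =
     (if t \<le> x j then (2 * h) ^ 6 * P6 ((t - x (j - 1)) / (2 * h))
      else (2 * h) ^ 6 * Q6 ((t - x (j - 1)) / (2 * h)))"

definition Rbar6 :: "(nat \<Rightarrow> real) \<Rightarrow> real \<Rightarrow> nat \<Rightarrow> (real \<Rightarrow> real) \<Rightarrow> real" where
  "Rbar6 x h n f =
     (\<Sum>j\<in>odds n. integral (panel x j) (\<lambda>t. Tbar6 x h j t * iter_deriv (panel x j) 6 f t))"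

text \<open>
  If \<open>f\<close> is only assumed to be six times differentiable inside the panels, its sixth derivative may
  fail to exist at an end point of a panel; such end points are left out of the supremum, which
  may then also be infinite. For \<open>f\<close> in \<open>C\<^sup>6\<close> of the closed panels nothing is left out.
\<close>

definition norm_deriv6 :: "(nat \<Rightarrow> real) \<Rightarrow> nat \<Rightarrow> (real \<Rightarrow> real) \<Rightarrow> ereal" where
  "norm_deriv6 x n f =
     (SUP j\<in>odds n. SUP t\<in>{t \<in> panel x j. times_differentiable_at 6 (panel x j) f t}.
        ereal \<bar>iter_deriv (panel x j) 6 f t\<bar>)"

end

theory Submission
  imports Defs
begin

text \<open>
  Everything happens on one panel \<open>[c, d]\<close> with \<open>d = c + 2h\<close>. There the kernel is a piecewise polynomial of
  degree six with leading coefficient \<open>1/6!\<close>: it vanishes to fourth order at both ends, and its halves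
  join at the midpoint up to the fourth derivative. Integrating \<open>\<integral> K f\<^sup>(\<^sup>6\<^sup>)\<close> by parts six times on
  each half therefore leaves \<open>\<integral> f\<close>, the values of \<open>f\<close> at the three nodes (from the fifth derivative
  of \<open>K\<close> at the ends and its jump at the midpoint) and the values of \<open>f'\<close> at the ends (from the fourth
  derivative of \<open>K\<close>). This is \<open>panel_quadrature\<close>. In the sum over the panels the terms with \<open>f'\<close> telescope.

  The kernel is nonnegative with integral \<open>D\<^sub>6 h\<^sup>7\<close> over a panel, so a panel contributes at most
  \<open>D\<^sub>6 h\<^sup>7 \<parallel>f\<^sup>(\<^sup>6\<^sup>)\<parallel>\<close> to the remainder (\<open>panel_remainder\<close>), and there are \<open>n = (b - a) / (2h)\<close> panels. If the norm
  is infinite, there is nothing to bound.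

  The delicate point is that \<open>f\<close> is smooth only inside the panels, so the boundary terms at \<open>c\<close>
  and \<open>d\<close> need an argument. When \<open>f\<^sup>(\<^sup>6\<^sup>)\<close> is bounded, so are all lower derivatives on the open panel
  (\<open>lower_derivatives_bounded\<close>). Those of order two to five are multiplied by derivatives of \<open>K\<close> that vanish
  at the ends, so these products tend to zero. The first derivative is Lipschitz and hence converges, and its
  limit is the one-sided derivative of \<open>f\<close> at the end (\<open>derivative_tendsto_at_end\<close>). The sum of the
  boundary terms is thus continuous on the closed half panels, which is all that the
  fundamental theorem of calculus needs (\<open>has_integral_parts\<close>).
\<close>

section \<open>Derivatives near the ends of an interval\<close>

lemma bounded_if_derivative_bounded:
  fixes g g' :: "real \<Rightarrow> real"
  assumes g: "\<And>t. t \<in> {c<..<d} \<Longrightarrow> (g has_real_derivative g' t) (at t)"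
    and g': "\<exists>B. \<forall>t\<in>{c<..<d}. \<bar>g' t\<bar> \<le> B"
  shows "\<exists>B. \<forall>t\<in>{c<..<d}. \<bar>g t\<bar> \<le> B"
proof (cases "c < d")
  case True
  obtain B where B: "\<And>t. t \<in> {c<..<d} \<Longrightarrow> \<bar>g' t\<bar> \<le> B"
    using g' by blast
  define m where "m = (c + d) / 2"
  have m: "m \<in> {c<..<d}"
    using True by (auto simp: m_def)
  have "\<bar>g t\<bar> \<le> \<bar>g m\<bar> + B * (d - c)" if t: "t \<in> {c<..<d}" for t
  proof -
    have "norm (g t - g m) \<le> B * norm (t - m)"
      by (rule field_differentiable_bound[where S = "{c<..<d}"])
        (use t m B in \<open>auto intro!: has_field_derivative_at_within[OF g]\<close>)
    moreover have "B * \<bar>t - m\<bar> \<le> B * (d - c)"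
      using t m B[OF m] by (intro mult_left_mono) auto
    ultimately show ?thesis
      by simp
  qed
  then show ?thesis
    by blast
qed auto

lemma lower_derivatives_bounded:
  fixes g :: "nat \<Rightarrow> real \<Rightarrow> real"
  assumes g: "\<And>k t. i \<le> k \<Longrightarrow> k < N \<Longrightarrow> t \<in> {c<..<d} \<Longrightarrow> (g k has_real_derivative g (Suc k) t) (at t)"
    and N: "\<exists>B. \<forall>t\<in>{c<..<d}. \<bar>g N t\<bar> \<le> B"
    and "i \<le> N"
  shows "\<exists>B. \<forall>t\<in>{c<..<d}. \<bar>g i t\<bar> \<le> B"
  using \<open>i \<le> N\<close> g
proof (induction i rule: inc_induct)
  case base
  show ?case by (rule N)
next
  case (step k)
  show ?case
    by (rule bounded_if_derivative_bounded[of c d "g k" "g (Suc k)"])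
      (use step in \<open>auto intro!: step.prems\<close>)
qed

text \<open>By the mean value theorem the difference quotient at \<open>e\<close> is a value of \<open>f'\<close> at a point closer
  to \<open>e\<close>; the Lipschitz bound then carries the limit of the quotient over to \<open>f'\<close>. Thus a
  derivative at an end point, about which nothing but its existence is known, is the limit
  of the derivatives inside.\<close>

lemma derivative_tendsto_at_end:
  fixes f f' :: "real \<Rightarrow> real"
  assumes f: "\<And>t. t \<in> {c..d} \<Longrightarrow> (f has_real_derivative f' t) (at t within {c..d})"
    and lip: "\<And>s t. s \<in> {c<..<d} \<Longrightarrow> t \<in> {c<..<d} \<Longrightarrow> \<bar>f' s - f' t\<bar> \<le> B * \<bar>s - t\<bar>"
    and e: "e \<in> {c..d}"
  shows "(f' \<longlongrightarrow> f' e) (at e within {c<..<d})"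
proof -
  define q where "q t = (f t - f e) / (t - e)" for t
  have "(q \<longlongrightarrow> f' e) (at e within {c..d})"
    using f[OF e] by (simp add: has_field_derivative_iff q_def[abs_def])
  then have q: "(q \<longlongrightarrow> f' e) (at e within {c<..<d})"
    by (rule tendsto_within_subset) auto
  have near: "\<bar>f' t - q t\<bar> \<le> \<bar>B\<bar> * \<bar>t - e\<bar>" if t: "t \<in> {c<..<d}" "t \<noteq> e" for t
  proof -
    define l u where "l = min t e" and "u = max t e"
    have lu: "l < u" "{l..u} \<subseteq> {c..d}"
      using t e by (auto simp: l_def u_def)
    have "\<exists>x\<in>{l<..<u}. f u - f l = f' x * (u - l)"
    proof (rule mvt_simple[OF lu(1)])
      fix x assume "l \<le> x" "x \<le> u"
      then show "(f has_derivative (*) (f' x)) (at x within {l..u})"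
        using f[of x] lu by (auto simp: has_field_derivative_def intro: has_derivative_subset)
    qed
    then obtain x where x: "x \<in> {l<..<u}" and mv: "f u - f l = f' x * (u - l)"
      by blast
    have "q t = f' x"
      using mv t(2) by (auto simp: q_def l_def u_def min_def max_def field_simps split: if_splits)
    moreover have "x \<in> {c<..<d}"
      using x lu by auto
    ultimately have "\<bar>f' t - q t\<bar> \<le> B * \<bar>t - x\<bar>"
      using lip[of t x] t by simp
    also have "\<dots> \<le> \<bar>B\<bar> * \<bar>t - e\<bar>"
      using x by (intro mult_mono) (auto simp: l_def u_def)
    finally show ?thesis .
  qed
  have "((\<lambda>t. f' t - q t) \<longlongrightarrow> 0) (at e within {c<..<d})"
  proof (rule Lim_null_comparison)
    show "\<forall>\<^sub>F t in at e within {c<..<d}. norm (f' t - q t) \<le> \<bar>B\<bar> * \<bar>t - e\<bar>"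
      using near by (auto simp: eventually_at_filter)
    show "((\<lambda>t. \<bar>B\<bar> * \<bar>t - e\<bar>) \<longlongrightarrow> 0) (at e within {c<..<d})"
      by (auto intro!: tendsto_eq_intros)
  qed
  from tendsto_add[OF this q] show ?thesis
    by simp
qed

section \<open>Repeated integration by parts against a polynomial\<close>

text \<open>The boundary term of \<open>N\<close> integrations by parts of \<open>\<integral> K(t - e) f\<^sup>(\<^sup>N\<^sup>)(t)\<close>, for \<open>g k\<close> the \<open>k\<close>-th
  derivative of \<open>f\<close>. The shift by \<open>e\<close> lets one polynomial serve every panel.\<close>

definition parts_boundary ::
    "real poly \<Rightarrow> real \<Rightarrow> nat \<Rightarrow> (nat \<Rightarrow> real \<Rightarrow> real) \<Rightarrow> real \<Rightarrow> real" where
  "parts_boundary K e N g t =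
     (\<Sum>k<N. (- 1) ^ k * poly ((pderiv ^^ k) K) (t - e) * g (N - 1 - k) t)"

lemma parts_boundary_has_derivative:
  assumes g: "\<And>k. k < N \<Longrightarrow> (g k has_real_derivative g (Suc k) t) (at t)"
  shows "(parts_boundary K e N g has_real_derivative
      poly K (t - e) * g N t - (- 1) ^ N * poly ((pderiv ^^ N) K) (t - e) * g 0 t) (at t)"
proof -
  define A where "A k = (- 1) ^ k * poly ((pderiv ^^ k) K) (t - e) * g (N - k) t" for k
  have "((\<lambda>t. (- 1) ^ k * poly ((pderiv ^^ k) K) (t - e) * g (N - 1 - k) t)
      has_real_derivative A k - A (Suc k)) (at t)" if "k < N" for k
  proof -
    have N: "Suc (N - Suc k) = N - k" "N - 1 - k < N"
      using that by auto
    have K: "((\<lambda>t. poly ((pderiv ^^ k) K) (t - e)) has_real_derivative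
        poly ((pderiv ^^ Suc k) K) (t - e)) (at t)"
      by (auto intro!: derivative_eq_intros DERIV_chain'[OF _ poly_DERIV])
    show ?thesis
      unfolding A_def
      by (rule derivative_eq_intros K g[OF N(2)] refl)+ (use N in \<open>simp add: algebra_simps\<close>)
  qed
  then have "(parts_boundary K e N g has_real_derivative (\<Sum>k<N. A k - A (Suc k))) (at t)"
    unfolding parts_boundary_def by (intro DERIV_sum) auto
  then show ?thesis
    unfolding sum_lessThan_telescope' by (simp add: A_def)
qed

text \<open>A derivative of order at least two is only known to be bounded near \<open>e\<close>, but the derivative of \<open>K\<close>
  that it is multiplied by tends to zero there.\<close>

lemma parts_boundary_tendsto_at_end:
  assumes K: "\<And>k. k + 2 < N \<Longrightarrow> poly ((pderiv ^^ k) K) 0 = 0"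
    and high: "\<And>k. 2 \<le> k \<Longrightarrow> k < N \<Longrightarrow> \<exists>B. \<forall>t\<in>S. \<bar>g k t\<bar> \<le> B"
    and low: "\<And>k. k < 2 \<Longrightarrow> (g k \<longlongrightarrow> g k e) (at e within S)"
  shows "(parts_boundary K e N g \<longlongrightarrow> parts_boundary K e N g e) (at e within S)"
  unfolding parts_boundary_def
proof (rule tendsto_sum)
  fix k assume "k \<in> {..<N}"
  then have k: "k < N" by simp
  have lim: "((\<lambda>t. (- 1) ^ k * poly ((pderiv ^^ k) K) (t - e)) \<longlongrightarrow>
      (- 1) ^ k * poly ((pderiv ^^ k) K) (e - e)) (at e within S)"
    by (intro tendsto_intros)
  show "((\<lambda>t. (- 1) ^ k * poly ((pderiv ^^ k) K) (t - e) * g (N - 1 - k) t) \<longlongrightarrow>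
      (- 1) ^ k * poly ((pderiv ^^ k) K) (e - e) * g (N - 1 - k) e) (at e within S)"
  proof (cases "k + 2 < N")
    case True
    then have "2 \<le> N - 1 - k" "N - 1 - k < N"
      by auto
    then obtain B where B: "\<And>t. t \<in> S \<Longrightarrow> \<bar>g (N - 1 - k) t\<bar> \<le> B"
      using high by blast
    show ?thesis
      using lim_null_mult_right_bounded[OF lim[unfolded diff_self K[OF True] mult_zero_right],
          of "g (N - 1 - k)" B] B K[OF True]
      by (simp add: eventually_at_filter)
  next
    case False
    then show ?thesis
      using k by (intro tendsto_mult lim low) auto
  qed
qed

text \<open>The fundamental theorem of calculus applies to the boundary term as an antiderivative. It
  asks for continuity on \<open>[p, q]\<close>, which is in question only at the end point \<open>e\<close>, and for
  differentiability inside.\<close>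

lemma has_integral_parts:
  fixes g :: "nat \<Rightarrow> real \<Rightarrow> real"
  assumes g0: "\<And>t. t \<in> {c..d} \<Longrightarrow> (g 0 has_real_derivative g 1 t) (at t within {c..d})"
    and g: "\<And>k t. 1 \<le> k \<Longrightarrow> k < N \<Longrightarrow> t \<in> {c<..<d} \<Longrightarrow> (g k has_real_derivative g (Suc k) t) (at t)"
    and bd: "\<exists>B. \<forall>t\<in>{c<..<d}. \<bar>g N t\<bar> \<le> B"
    and N: "2 \<le> N"
    and K: "\<And>k. k + 2 < N \<Longrightarrow> poly ((pderiv ^^ k) K) 0 = 0"
    and e: "e \<in> {c..d}"
    and pq: "p \<le> q" "{p..q} \<subseteq> insert e {c<..<d}" "{p<..<q} \<subseteq> {c<..<d}"
  shows "((\<lambda>t. poly K (t - e) * g N t - (- 1) ^ N * poly ((pderiv ^^ N) K) (t - e) * g 0 t)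
    has_integral parts_boundary K e N g q - parts_boundary K e N g p) {p..q}"
proof -
  have deriv: "(g k has_real_derivative g (Suc k) t) (at t)" if "k < N" "t \<in> {c<..<d}" for k t
  proof (cases "k = 0")
    case True
    have "at t within {c..d} = at t"
      using that(2) by (intro at_within_interior) auto
    with True show ?thesis
      using g0[of t] that(2) by auto
  next
    case False
    with that show ?thesis
      by (intro g) auto
  qed
  have bounded: "\<exists>B. \<forall>t\<in>{c<..<d}. \<bar>g k t\<bar> \<le> B" if "k \<le> N" for k
    by (rule lower_derivatives_bounded[where N = N]) (use deriv bd that in auto)
  obtain B where B: "\<And>t. t \<in> {c<..<d} \<Longrightarrow> \<bar>g 2 t\<bar> \<le> B"
    using bounded[OF N] by blast
  have "\<bar>g 1 s - g 1 t\<bar> \<le> B * \<bar>s - t\<bar>" if "s \<in> {c<..<d}" "t \<in> {c<..<d}" for s t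
    using field_differentiable_bound[of "{c<..<d}" "g 1" "g 2" B s t] that B g[of 1] N
    by (auto simp: numeral_2_eq_2 intro: has_field_derivative_at_within)
  then have lim1: "(g 1 \<longlongrightarrow> g 1 e) (at e within {c<..<d})"
    using derivative_tendsto_at_end[OF g0 _ e] by blast
  have "(g 0 \<longlongrightarrow> g 0 e) (at e within {c..d})"
    using g0[OF e] by (auto simp: continuous_within dest: DERIV_continuous)
  then have lim0: "(g 0 \<longlongrightarrow> g 0 e) (at e within {c<..<d})"
    by (rule tendsto_within_subset) auto
  have low: "(g k \<longlongrightarrow> g k e) (at e within {c<..<d})" if "k < 2" for k
    using that lim0 lim1 by (cases k) (auto simp: less_Suc_eq numeral_2_eq_2)
  have at_e: "(parts_boundary K e N g \<longlongrightarrow> parts_boundary K e N g e) (at e within {c<..<d})"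
    by (rule parts_boundary_tendsto_at_end) (use K bounded low in auto)
  have D: "(parts_boundary K e N g has_real_derivative
      poly K (t - e) * g N t - (- 1) ^ N * poly ((pderiv ^^ N) K) (t - e) * g 0 t) (at t)"
    if "t \<in> {c<..<d}" for t
    by (rule parts_boundary_has_derivative) (use deriv that in auto)
  show ?thesis
  proof (rule fundamental_theorem_of_calculus_interior[OF pq(1)])
    show "continuous_on {p..q} (parts_boundary K e N g)"
      unfolding continuous_on_eq_continuous_within
    proof
      fix t assume t: "t \<in> {p..q}"
      show "continuous (at t within {p..q}) (parts_boundary K e N g)"
      proof (cases "t \<in> {c<..<d}")
        case True
        then show ?thesis
          using D DERIV_isCont continuous_at_imp_continuous_at_within by blast
      next
        case False
        then have "t = e"
          using t pq by auto
        moreover have "at e within {p..q} \<le> at e within {c<..<d}"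
          using pq(2) unfolding at_within_def by (intro inf_mono) auto
        ultimately show ?thesis
          using at_e by (auto simp: continuous_within intro: tendsto_mono)
      qed
    qed
    show "\<And>t. t \<in> {p<..<q} \<Longrightarrow> (parts_boundary K e N g has_vector_derivative
        poly K (t - e) * g N t - (- 1) ^ N * poly ((pderiv ^^ N) K) (t - e) * g 0 t) (at t)"
      using D pq(3) by (auto simp: has_real_derivative_iff_has_vector_derivative)
  qed
qed

section \<open>The kernel on one panel\<close>

text \<open>On \<open>[c, c + 2h]\<close> the kernel is \<open>half_kernel h\<close> in the variable \<open>t - c\<close> up to the midpoint and,
  being symmetric about it, \<open>half_kernel (- h)\<close> in the variable \<open>t - (c + 2h)\<close> beyond it.\<close>

definition half_kernel :: "real \<Rightarrow> real poly" where
  "half_kernel h = smult (1 / 720) [:0, 0, 0, 0, 2 * h\<^sup>2, - (14 / 5) * h, 1:]"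

definition panel_kernel :: "real \<Rightarrow> real \<Rightarrow> real \<Rightarrow> real" where
  "panel_kernel c h t =
     (if t \<le> c + h then poly (half_kernel h) (t - c) else poly (half_kernel (- h)) (t - (c + 2 * h)))"

lemma poly_half_kernel:
  "poly (half_kernel h) u = 1 / 720 * u ^ 4 * (u\<^sup>2 - 14 / 5 * h * u + 2 * h\<^sup>2)"
  by (simp add: half_kernel_def algebra_simps eval_nat_numeral)

lemma Tbar6_eq_panel_kernel:
  assumes "h > 0" "x (j - 1) = c" "x j = c + h"
  shows "Tbar6 x h j t = panel_kernel c h t"
proof -
  define s where "s = (t - c) / (2 * h)"
  have s: "t - c = 2 * h * s" "t - (c + 2 * h) = 2 * h * (s - 1)"
    using \<open>h > 0\<close> by (auto simp: s_def field_simps)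
  have "(2 * h) ^ 6 * P6 s = poly (half_kernel h) (t - c)"
    unfolding s P6_def poly_half_kernel fact_numeral
    by (simp add: power_mult_distrib field_simps eval_nat_numeral)
  moreover have "(2 * h) ^ 6 * Q6 s = poly (half_kernel (- h)) (t - (c + 2 * h))"
    unfolding s Q6_def poly_half_kernel
    by (simp add: power_mult_distrib field_simps eval_nat_numeral fact_numeral)
  ultimately show ?thesis
    using assms by (simp add: Tbar6_def panel_kernel_def s_def)
qed

lemma half_kernel_derivatives_at_0:
  "k < 4 \<Longrightarrow> poly ((pderiv ^^ k) (half_kernel h)) 0 = 0"
  "poly ((pderiv ^^ 4) (half_kernel h)) 0 = h\<^sup>2 / 15"
  "poly ((pderiv ^^ 5) (half_kernel h)) 0 = - (7 / 15) * h"
  by (auto simp: half_kernel_def eval_nat_numeral pderiv_pCons pderiv_smult algebra_simps less_Suc_eq)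

lemma half_kernel_sixth_derivative:
  "poly ((pderiv ^^ 6) (half_kernel h)) u = 1"
  by (auto simp: half_kernel_def eval_nat_numeral pderiv_pCons pderiv_smult algebra_simps)

text \<open>At the midpoint the derivatives of orders 1 and 3 vanish and those of even order are even in
  \<open>h\<close>, so the two halves of the kernel fit together up to the fourth derivative. The fifth
  derivative jumps, which is what puts a weight on \<open>f\<close> at the midpoint.\<close>

lemma half_kernel_derivatives_at_midpoint:
  "poly (half_kernel h) h = h ^ 6 / 3600"
  "poly (pderiv (half_kernel h)) h = 0"
  "poly ((pderiv ^^ 2) (half_kernel h)) h = - (h ^ 4 / 360)"
  "poly ((pderiv ^^ 3) (half_kernel h)) h = 0"
  "poly ((pderiv ^^ 4) (half_kernel h)) h = h\<^sup>2 / 10"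
  "poly ((pderiv ^^ 5) (half_kernel h)) h = 8 / 15 * h"
  by (auto simp: half_kernel_def eval_nat_numeral pderiv_pCons pderiv_smult algebra_simps)

lemma parts_boundary_half_kernel_at_end:
  "parts_boundary (half_kernel h) e 6 g e = h\<^sup>2 / 15 * g 1 e + 7 / 15 * h * g 0 e"
proof -
  have "{..<6::nat} = {0, 1, 2, 3, 4, 5}"
    by auto
  then show ?thesis
    using half_kernel_derivatives_at_0(1)[of 0 h] half_kernel_derivatives_at_0(1)[of 1 h]
      half_kernel_derivatives_at_0(1)[of 2 h] half_kernel_derivatives_at_0(1)[of 3 h]
      half_kernel_derivatives_at_0(2,3)[of h]
    by (simp add: parts_boundary_def)
qed

lemma parts_boundary_half_kernel_at_midpoint:
  assumes "m - e = h"
  shows "parts_boundary (half_kernel h) e 6 g m =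
    h ^ 6 / 3600 * g 5 m - h ^ 4 / 360 * g 3 m + h\<^sup>2 / 10 * g 1 m - 8 / 15 * h * g 0 m"
proof -
  have "{..<6::nat} = {0, 1, 2, 3, 4, 5}"
    by auto
  then show ?thesis
    by (simp add: parts_boundary_def assms half_kernel_derivatives_at_midpoint)
qed

text \<open>The quadratic factor is \<open>(u - 7/5 h)\<^sup>2 + h\<^sup>2/25\<close>. Because the kernel has one sign, the constant
  of the error bound is just its integral.\<close>

lemma half_kernel_nonneg: "0 \<le> poly (half_kernel h) u"
proof -
  have "u\<^sup>2 - 14 / 5 * h * u + 2 * h\<^sup>2 = (u - 7 / 5 * h)\<^sup>2 + (h / 5)\<^sup>2"
    by (simp add: power2_eq_square algebra_simps)
  also have "\<dots> \<ge> 0"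
    by simp
  finally show ?thesis
    unfolding poly_half_kernel by simp
qed

lemma panel_kernel_nonneg: "0 \<le> panel_kernel c h t"
  by (simp add: panel_kernel_def half_kernel_nonneg)

lemma panel_kernel_right_half:
  "t \<in> {c + h..c + 2 * h} \<Longrightarrow> panel_kernel c h t = poly (half_kernel (- h)) (t - (c + 2 * h))"
  using half_kernel_derivatives_at_midpoint(1)[of h] half_kernel_derivatives_at_midpoint(1)[of "- h"]
  by (cases "t = c + h") (auto simp: panel_kernel_def)

lemma continuous_on_panel_kernel:
  "h \<ge> 0 \<Longrightarrow> continuous_on {c..c + 2 * h} (panel_kernel c h)"
proof -
  assume "h \<ge> 0"
  then have "{c..c + 2 * h} = {c..c + h} \<union> {c + h..c + 2 * h}"
    by auto
  moreover have "continuous_on {c..c + h} (panel_kernel c h)"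
    by (rule continuous_on_eq[where f = "\<lambda>t. poly (half_kernel h) (t - c)"])
      (auto simp: panel_kernel_def intro!: continuous_intros)
  moreover have "continuous_on {c + h..c + 2 * h} (panel_kernel c h)"
    by (rule continuous_on_eq[where f = "\<lambda>t. poly (half_kernel (- h)) (t - (c + 2 * h))"])
      (auto simp: panel_kernel_right_half intro!: continuous_intros)
  ultimately show ?thesis
    by (simp add: continuous_on_closed_Un)
qed

text \<open>The function \<open>F\<close> stands for whatever is done with the value of the kernel, so that the
  kernel and its products with derivatives are treated at once.\<close>

lemma has_integral_panel_halves:
  fixes F :: "real \<Rightarrow> real \<Rightarrow> real"
  assumes "h > 0"
    and "((\<lambda>t. F (poly (half_kernel h) (t - c)) t) has_integral I) {c..c + h}"
    and "((\<lambda>t. F (poly (half_kernel (- h)) (t - (c + 2 * h))) t) has_integral J) {c + h..c + 2 * h}"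
  shows "((\<lambda>t. F (panel_kernel c h t) t) has_integral I + J) {c..c + 2 * h}"
proof (rule has_integral_combine[where c = "c + h"])
  show "((\<lambda>t. F (panel_kernel c h t) t) has_integral I) {c..c + h}"
    by (rule has_integral_eq[OF _ assms(2)]) (auto simp: panel_kernel_def)
  show "((\<lambda>t. F (panel_kernel c h t) t) has_integral J) {c + h..c + 2 * h}"
    by (rule has_integral_eq[OF _ assms(3)]) (auto simp: panel_kernel_right_half)
qed (use assms(1) in auto)

lemma has_integral_panel_kernel:
  assumes "h > 0"
  shows "(panel_kernel c h has_integral D6 * h ^ 7) {c..c + 2 * h}"
proof -
  define A where "A h u = 1 / 720 * (u ^ 7 / 7 - 14 / 30 * h * u ^ 6 + 2 / 5 * h\<^sup>2 * u ^ 5)" for h u :: real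
  have int: "((\<lambda>t. poly (half_kernel r) (t - e)) has_integral A r (q - e) - A r (p - e)) {p..q}"
    if "p \<le> q" for r e p q :: real
  proof (rule fundamental_theorem_of_calculus[OF that])
    fix t
    have "(A r has_real_derivative poly (half_kernel r) u) (at u)" for u
      unfolding poly_half_kernel A_def
      by (auto intro!: derivative_eq_intros simp: algebra_simps eval_nat_numeral)
    from this[of "t - e"] have "((\<lambda>t. A r (t - e)) has_real_derivative poly (half_kernel r) (t - e)) (at t)"
      using DERIV_shift[of "A r" _ t "- e"] by simp
    then show "((\<lambda>t. A r (t - e)) has_vector_derivative poly (half_kernel r) (t - e))
        (at t within {p..q})"
      by (simp add: has_real_derivative_iff_has_vector_derivative has_vector_derivative_at_within)
  qed
  have "(panel_kernel c h has_integral
      (A h (c + h - c) - A h (c - c)) +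
      (A (- h) (c + 2 * h - (c + 2 * h)) - A (- h) (c + h - (c + 2 * h)))) {c..c + 2 * h}"
    by (rule has_integral_panel_halves[where F = "\<lambda>y t. y", OF assms int int]) (use assms in auto)
  moreover have "(A h (c + h - c) - A h (c - c)) +
      (A (- h) (c + 2 * h - (c + 2 * h)) - A (- h) (c + h - (c + 2 * h))) = D6 * h ^ 7"
    by (simp add: A_def D6_def C6_def eval_nat_numeral algebra_simps)
  ultimately show ?thesis
    by simp
qed

text \<open>Nothing is known about \<open>\<phi>\<close> at the end points, where a derivative may fail to exist; so the
  estimates are made on the open panel, which has the same integral.\<close>

lemma panel_remainder:
  assumes h: "h > 0"
    and cont: "continuous_on {c<..<c + 2 * h} \<phi>"
    and M: "\<And>t. t \<in> {c<..<c + 2 * h} \<Longrightarrow> \<bar>\<phi> t\<bar> \<le> M"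
  shows "(\<lambda>t. panel_kernel c h t * \<phi> t) integrable_on {c..c + 2 * h}"
    and "\<bar>integral {c..c + 2 * h} (\<lambda>t. panel_kernel c h t * \<phi> t)\<bar> \<le> D6 * h ^ 7 * M"
proof -
  let ?S = "{c<..<c + 2 * h}"
  have int: "((\<lambda>t. panel_kernel c h t * M) has_integral D6 * h ^ 7 * M) ?S"
    using has_integral_mult_left[OF has_integral_panel_kernel[OF h]]
    by (simp add: has_integral_Icc_iff_Ioo)
  have bound: "\<bar>panel_kernel c h t * \<phi> t\<bar> \<le> panel_kernel c h t * M" if "t \<in> ?S" for t
    using M[OF that] panel_kernel_nonneg[of c h t] by (simp add: abs_mult mult_left_mono)
  have "continuous_on ?S (panel_kernel c h)"
    by (rule continuous_on_subset[OF continuous_on_panel_kernel]) (use h in auto)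
  then have "continuous_on ?S (\<lambda>t. panel_kernel c h t * \<phi> t)"
    by (intro continuous_intros cont)
  then have "(\<lambda>t. panel_kernel c h t * \<phi> t) \<in> borel_measurable (lebesgue_on ?S)"
    by (rule continuous_imp_measurable_on_sets_lebesgue) simp
  then have integrable: "(\<lambda>t. panel_kernel c h t * \<phi> t) integrable_on ?S"
    by (rule measurable_bounded_by_integrable_imp_integrable_real[OF _ has_integral_integrable[OF int] bound])
      auto
  then show "(\<lambda>t. panel_kernel c h t * \<phi> t) integrable_on {c..c + 2 * h}"
    by (simp add: integrable_on_open_interval_real)
  show "\<bar>integral {c..c + 2 * h} (\<lambda>t. panel_kernel c h t * \<phi> t)\<bar> \<le> D6 * h ^ 7 * M"
    using integral_norm_bound_integral[OF integrable has_integral_integrable[OF int]] bound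
    unfolding integral_unique[OF int] integral_open_interval_real real_norm_def by blast
qed

text \<open>Each half is integrated by parts from its own end. At the midpoint the boundary terms with the
  first, third and fifth derivatives of \<open>f\<close> cancel between the halves.\<close>

lemma panel_quadrature:
  fixes g :: "nat \<Rightarrow> real \<Rightarrow> real"
  assumes h: "h > 0" and d: "d = c + 2 * h"
    and g0: "\<And>t. t \<in> {c..d} \<Longrightarrow> (g 0 has_real_derivative g 1 t) (at t within {c..d})"
    and g: "\<And>k t. 1 \<le> k \<Longrightarrow> k < 6 \<Longrightarrow> t \<in> {c<..<d} \<Longrightarrow> (g k has_real_derivative g (Suc k) t) (at t)"
    and bd: "\<And>t. t \<in> {c<..<d} \<Longrightarrow> \<bar>g 6 t\<bar> \<le> M"
  shows "((\<lambda>t. panel_kernel c h t * g 6 t - g 0 t) has_integral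
    h\<^sup>2 / 15 * (g 1 d - g 1 c) - h / 15 * (7 * g 0 c + 16 * g 0 (c + h) + 7 * g 0 d)) {c..d}"
proof -
  have half: "((\<lambda>t. poly (half_kernel r) (t - e) * g 6 t - g 0 t) has_integral
      parts_boundary (half_kernel r) e 6 g q - parts_boundary (half_kernel r) e 6 g p) {p..q}"
    if "e \<in> {c..d}" "p \<le> q" "{p..q} \<subseteq> insert e {c<..<d}" "{p<..<q} \<subseteq> {c<..<d}" for r e p q
  proof -
    have "\<exists>B. \<forall>t\<in>{c<..<d}. \<bar>g 6 t\<bar> \<le> B"
      using bd by blast
    from has_integral_parts[where N = 6 and K = "half_kernel r", OF g0 g this _ _ that]
    show ?thesis
      by (simp add: half_kernel_sixth_derivative half_kernel_derivatives_at_0(1))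
  qed
  let ?m = "c + h"
  have "((\<lambda>t. panel_kernel c h t * g 6 t - g 0 t) has_integral
      (parts_boundary (half_kernel h) c 6 g ?m - parts_boundary (half_kernel h) c 6 g c) +
      (parts_boundary (half_kernel (- h)) d 6 g d - parts_boundary (half_kernel (- h)) d 6 g ?m)) {c..d}"
    unfolding d by (rule has_integral_panel_halves[where F = "\<lambda>y t. y * g 6 t - g 0 t", OF h])
      (use h d in \<open>auto intro!: half[unfolded d]\<close>)
  moreover have "(parts_boundary (half_kernel h) c 6 g ?m - parts_boundary (half_kernel h) c 6 g c) +
      (parts_boundary (half_kernel (- h)) d 6 g d - parts_boundary (half_kernel (- h)) d 6 g ?m) =
      h\<^sup>2 / 15 * (g 1 d - g 1 c) - h / 15 * (7 * g 0 c + 16 * g 0 ?m + 7 * g 0 d)"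
    by (simp add: parts_boundary_half_kernel_at_end parts_boundary_half_kernel_at_midpoint d algebra_simps)
  ultimately show ?thesis
    by simp
qed

section \<open>Sixth derivatives on the open panels\<close>

lemma iter_deriv_Suc:
  "iter_deriv S (Suc k) f t = vector_derivative (iter_deriv S k f) (at t within S)"
  by (simp add: iter_deriv_def)

text \<open>At interior points a derivative relative to the closed panel is the ordinary one, so it does not
  matter that smoothness is assumed relative to the open panel.\<close>

lemma iter_deriv_interior:
  assumes "t \<in> {c<..<d}"
  shows "iter_deriv {c..d} k f t = iter_deriv {c<..<d} k f t"
  using assms
proof (induction k arbitrary: t)
  case 0
  then show ?case by (simp add: iter_deriv_def)
next
  case (Suc k)
  have within: "at t within {c..d} = at t" "at t within {c<..<d} = at t"
    using Suc.prems by (auto intro: at_within_interior at_within_open)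
  have "\<forall>\<^sub>F s in nhds t. s \<in> {c<..<d}"
    using Suc.prems by (intro eventually_nhds_in_open) auto
  then have "\<forall>\<^sub>F s in nhds t. s \<in> UNIV \<longrightarrow> iter_deriv {c..d} k f s = iter_deriv {c<..<d} k f s"
    by (rule eventually_mono) (use Suc.IH in auto)
  then show ?case
    unfolding iter_deriv_Suc within by (rule vector_derivative_cong_eq) (use Suc in auto)
qed

lemma C_on_open_has_derivative:
  assumes C: "C_on N {c<..<d} f" and "k < N" and t: "t \<in> {c<..<d}"
  shows "(iter_deriv {c..d} k f has_real_derivative iter_deriv {c..d} (Suc k) f t) (at t)"
proof -
  have "at t within {c<..<d} = at t"
    using t by (auto intro: at_within_open)
  then have "iter_deriv {c<..<d} k f differentiable (at t)"
    using assms unfolding C_on_def times_differentiable_at_def by metis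
  moreover have "iter_deriv {c<..<d} (Suc k) f t = vector_derivative (iter_deriv {c<..<d} k f) (at t)"
    by (simp add: iter_deriv_Suc \<open>at t within {c<..<d} = at t\<close>)
  ultimately have "(iter_deriv {c<..<d} k f has_real_derivative iter_deriv {c<..<d} (Suc k) f t) (at t)"
    by (simp add: has_real_derivative_iff_has_vector_derivative vector_derivative_works)
  then have "(iter_deriv {c..d} k f has_real_derivative iter_deriv {c<..<d} (Suc k) f t) (at t)"
    by (rule has_field_derivative_transform_within_open[where S = "{c<..<d}"])
      (use t in \<open>auto simp: iter_deriv_interior\<close>)
  then show ?thesis
    by (simp only: iter_deriv_interior[OF t])
qed

lemma C_on_open_times_differentiable:
  assumes "C_on N {c<..<d} f" "t \<in> {c<..<d}"
  shows "times_differentiable_at N {c..d} f t"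
  unfolding times_differentiable_at_def
proof (intro allI impI)
  fix i assume "i < N"
  then show "iter_deriv {c..d} i f differentiable (at t within {c..d})"
    using C_on_open_has_derivative[OF assms(1) _ assms(2)] real_differentiable_def
    by (meson differentiable_at_withinI)
qed

lemma C_on_open_continuous:
  assumes "C_on N {c<..<d} f"
  shows "continuous_on {c<..<d} (iter_deriv {c..d} N f)"
  by (rule continuous_on_eq[where f = "iter_deriv {c<..<d} N f"])
    (use assms in \<open>auto simp: C_on_def iter_deriv_interior\<close>)

lemma odds_eq_image: "odds n = (\<lambda>i. 2 * i + 1) ` {..<n}"
  by (force simp: odds_def elim!: oddE)

lemma sum_odds: "(\<Sum>j\<in>odds n. F j) = (\<Sum>i<n. F (2 * i + 1))"
  unfolding odds_eq_image by (subst sum.reindex) (auto simp: inj_on_def)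

lemma has_integral_consecutive_intervals:
  fixes f :: "real \<Rightarrow> real"
  assumes "\<And>i. i < n \<Longrightarrow> y i \<le> y (Suc i)"
    and "\<And>i. i < n \<Longrightarrow> f integrable_on {y i..y (Suc i)}"
  shows "(f has_integral (\<Sum>i<n. integral {y i..y (Suc i)} f)) {y 0..y n} \<and> y 0 \<le> y n"
  using assms
proof (induction n)
  case (Suc n)
  then show ?case
    by (auto intro!: has_integral_combine[where c = "y n"] integrable_integral intro: order_trans)
qed auto

section \<open>The error bound\<close>

theorem theorem9:
  fixes f :: "real \<Rightarrow> real" and a b h :: real and n :: nat and x :: "nat \<Rightarrow> real"
  assumes "n \<ge> 1"
    and "x 0 = a" and "x (2 * n) = b"
    and "\<forall>i<2 * n. x i < x (i + 1)"
    and "\<forall>i<2 * n. x (i + 1) = x i + h"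
    and "h = (b - a) / (2 * real n)"
    and "\<forall>j\<in>odds n. C_on 6 {x (j - 1) <..< x (j + 1)} f"
  shows "ereal \<bar>Rbar6 x h n f\<bar> \<le> ereal (1 / 2 * D6 * h ^ 6 * (b - a)) * norm_deriv6 x n f
    \<and> (norm_deriv6 x n f < \<infinity> \<longrightarrow>
        (\<forall>j\<in>odds n. (\<lambda>t. Tbar6 x h j t * iter_deriv (panel x j) 6 f t) integrable_on panel x j))
    \<and> (norm_deriv6 x n f < \<infinity> \<and> f differentiable_on {a..b} \<longrightarrow>
        integral {a..b} f =
          h / 15 * (\<Sum>j\<in>odds n. 7 * f (x (j - 1)) + 16 * f (x j) + 7 * f (x (j + 1)))
          - h ^ 2 / 15 * (vector_derivative f (at b within {a..b})
                          - vector_derivative f (at a within {a..b}))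
          + Rbar6 x h n f)"
proof -
  define y where "y i = x (2 * i)" for i
  define g where "g i k = iter_deriv {y i..y i + 2 * h} k f" for i k
  define K where "K i = panel_kernel (y i) h" for i
  have "x 0 < x 1" "x 1 = x 0 + h"
    using assms(1) assms(4,5)[rule_format, of 0] by simp_all
  then have h: "h > 0"
    by simp
  have x: "x k = a + k * h" if "k \<le> 2 * n" for k
    using that by (induction k) (use assms(2,5) in \<open>auto simp: algebra_simps\<close>)
  have nodes: "x (2 * i + 1) = y i + h" "x (2 * i + 1 + 1) = y i + 2 * h" "y (Suc i) = y i + 2 * h"
    "a \<le> y i" "y i + 2 * h \<le> b" if "i < n" for i
  proof -
    have "real (2 * i + 2) * h \<le> real (2 * n) * h"
      using that h by (intro mult_right_mono) auto
    then show "x (2 * i + 1) = y i + h" "x (2 * i + 1 + 1) = y i + 2 * h" "y (Suc i) = y i + 2 * h"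
      "a \<le> y i" "y i + 2 * h \<le> b"
      using that h x[of "2 * i"] x[of "2 * i + 1"] x[of "2 * i + 2"] x[of "2 * n"] assms(3)
      by (auto simp: y_def algebra_simps)
  qed
  have panel: "panel x (2 * i + 1) = {y i..y i + 2 * h}" if "i < n" for i
    using nodes[OF that] by (simp add: panel_def y_def)
  have C: "C_on 6 {y i<..<y i + 2 * h} f" if "i < n" for i
  proof -
    have "2 * i + 1 \<in> odds n"
      using that by (auto simp: odds_eq_image)
    with assms(7) have "C_on 6 {x (2 * i + 1 - 1)<..<x (2 * i + 1 + 1)} f"
      by blast
    then show ?thesis
      using nodes[OF that] by (simp add: y_def)
  qed
  have T: "Tbar6 x h (2 * i + 1) t = K i t" if "i < n" for i t
    unfolding K_def by (rule Tbar6_eq_panel_kernel[OF h]) (use nodes[OF that] in \<open>auto simp: y_def\<close>)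
  have R: "Rbar6 x h n f = (\<Sum>i<n. integral {y i..y i + 2 * h} (\<lambda>t. K i t * g i 6 t))"
    unfolding Rbar6_def sum_odds by (rule sum.cong) (auto simp: panel[simplified] T[simplified] g_def)
  have le_norm: "ereal \<bar>g i 6 t\<bar> \<le> norm_deriv6 x n f"
    if "i < n" "t \<in> {y i<..<y i + 2 * h}" for i t
  proof -
    have "2 * i + 1 \<in> odds n"
      using that by (auto simp: odds_eq_image)
    moreover have "t \<in> {t \<in> panel x (2 * i + 1). times_differentiable_at 6 (panel x (2 * i + 1)) f t}"
      using that C_on_open_times_differentiable[OF C] by (auto simp: panel[simplified])
    ultimately have "ereal \<bar>iter_deriv (panel x (2 * i + 1)) 6 f t\<bar> \<le> norm_deriv6 x n f"
      unfolding norm_deriv6_def by (intro SUP_upper2[where i = "2 * i + 1"] SUP_upper2[where i = t]) auto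
    then show ?thesis
      using that by (simp add: panel[simplified] g_def)
  qed
  have "0 \<le> ereal \<bar>g 0 6 (y 0 + h)\<bar>"
    by simp
  also have "\<dots> \<le> norm_deriv6 x n f"
    using assms(1) h by (intro le_norm) auto
  finally have norm_nonneg: "0 \<le> norm_deriv6 x n f" .
  have ba: "b - a = 2 * real n * h"
    using assms(1,6) by simp
  show ?thesis
  proof (cases "norm_deriv6 x n f")
    case PInf
    have "0 < 1 / 2 * D6 * h ^ 6 * (b - a)"
      using h assms(1) by (simp add: D6_def C6_def ba)
    then show ?thesis
      using PInf by auto
  next
    case MInf
    then show ?thesis
      using norm_nonneg by simp
  next
    case (real M)
    have M: "\<bar>g i 6 t\<bar> \<le> M" if "i < n" "t \<in> {y i<..<y i + 2 * h}" for i t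
      using le_norm[OF that] real by simp
    have remainder: "(\<lambda>t. K i t * g i 6 t) integrable_on {y i..y i + 2 * h}"
      "\<bar>integral {y i..y i + 2 * h} (\<lambda>t. K i t * g i 6 t)\<bar> \<le> D6 * h ^ 7 * M" if "i < n" for i
    proof -
      have "continuous_on {y i<..<y i + 2 * h} (g i 6)"
        unfolding g_def by (rule C_on_open_continuous[OF C[OF that]])
      from panel_remainder[OF h this M[OF that]]
      show "(\<lambda>t. K i t * g i 6 t) integrable_on {y i..y i + 2 * h}"
        "\<bar>integral {y i..y i + 2 * h} (\<lambda>t. K i t * g i 6 t)\<bar> \<le> D6 * h ^ 7 * M"
        by (auto simp: K_def)
    qed
    have "\<bar>Rbar6 x h n f\<bar> \<le> (\<Sum>i<n. D6 * h ^ 7 * M)"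
      unfolding R using remainder(2) by (intro order_trans[OF sum_abs] sum_mono) auto
    also have "\<dots> = 1 / 2 * D6 * h ^ 6 * (b - a) * M"
      by (simp add: ba eval_nat_numeral)
    finally have bound: "ereal \<bar>Rbar6 x h n f\<bar> \<le> ereal (1 / 2 * D6 * h ^ 6 * (b - a)) * norm_deriv6 x n f"
      by (simp add: real)
    have integrable: "(\<lambda>t. Tbar6 x h j t * iter_deriv (panel x j) 6 f t) integrable_on panel x j"
      if j: "j \<in> odds n" for j
    proof -
      obtain i where "i < n" "j = 2 * i + 1"
        using j by (auto simp: odds_eq_image)
      then show ?thesis
        using remainder(1)[of i] by (simp add: panel[simplified] T[simplified] g_def)
    qed
    have quadrature: "integral {a..b} f =
          h / 15 * (\<Sum>j\<in>odds n. 7 * f (x (j - 1)) + 16 * f (x j) + 7 * f (x (j + 1)))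
          - h ^ 2 / 15 * (vector_derivative f (at b within {a..b})
                          - vector_derivative f (at a within {a..b}))
          + Rbar6 x h n f"
      if diff: "f differentiable_on {a..b}"
    proof -
      define f' where "f' t = vector_derivative f (at t within {a..b})" for t
      define W where "W i = 7 * f (y i) + 16 * f (y i + h) + 7 * f (y i + 2 * h)" for i
      have f': "(f has_real_derivative f' t) (at t within {a..b})" if "t \<in> {a..b}" for t
        using diff that unfolding f'_def differentiable_on_def vector_derivative_works
        by (simp add: has_real_derivative_iff_has_vector_derivative)
      have cont: "continuous_on {a..b} f"
        using diff by (rule differentiable_imp_continuous_on)
      have sub: "{y i..y i + 2 * h} \<subseteq> {a..b}" if "i < n" for i
        using nodes[OF that] by auto
      have f_int: "f integrable_on {y i..y i + 2 * h}" if "i < n" for i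
        using continuous_on_subset[OF cont sub[OF that]] by (rule integrable_continuous_real)
      \<comment> \<open>At a node shared by two panels, both one-sided derivatives are the derivative within
        \<open>{a..b}\<close>; this is why the derivative terms of neighbouring panels cancel.\<close>
      have g1: "g i 1 t = f' t" and g01: "(g i 0 has_real_derivative g i 1 t) (at t within {y i..y i + 2 * h})"
        if i: "i < n" and t: "t \<in> {y i..y i + 2 * h}" for i t
      proof -
        have D: "(f has_real_derivative f' t) (at t within {y i..y i + 2 * h})"
          using f'[of t] t sub[OF i] by (intro DERIV_subset[OF f']) auto
        have "vector_derivative f (at t within {y i..y i + 2 * h}) = f' t"
          by (rule vector_derivative_within_closed_interval)
            (use D h t in \<open>auto simp: has_real_derivative_iff_has_vector_derivative\<close>)
        then show "g i 1 t = f' t"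
          by (simp add: g_def iter_deriv_def)
        then show "(g i 0 has_real_derivative g i 1 t) (at t within {y i..y i + 2 * h})"
          using D by (simp add: g_def iter_deriv_def)
      qed
      have panel_integral: "integral {y i..y i + 2 * h} f = h / 15 * W i
          - h\<^sup>2 / 15 * (f' (y (Suc i)) - f' (y i)) + integral {y i..y i + 2 * h} (\<lambda>t. K i t * g i 6 t)"
        if i: "i < n" for i
      proof -
        have "((\<lambda>t. K i t * g i 6 t - g i 0 t) has_integral
            h\<^sup>2 / 15 * (g i 1 (y i + 2 * h) - g i 1 (y i))
            - h / 15 * (7 * g i 0 (y i) + 16 * g i 0 (y i + h) + 7 * g i 0 (y i + 2 * h)))
            {y i..y i + 2 * h}"
          unfolding K_def
          by (rule panel_quadrature[OF h refl g01[OF i] _ M[OF i]])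
            (use C_on_open_has_derivative[OF C[OF i]] in \<open>auto simp: g_def\<close>)
        moreover have "g i 0 = f"
          by (simp add: g_def iter_deriv_def)
        ultimately have "integral {y i..y i + 2 * h} (\<lambda>t. K i t * g i 6 t - f t) =
            h\<^sup>2 / 15 * (f' (y (Suc i)) - f' (y i)) - h / 15 * W i"
          using g1[OF i] h nodes(3)[OF i] by (auto simp: W_def intro: integral_unique)
        then show ?thesis
          using integral_diff[OF remainder(1)[OF i] f_int[OF i]] by simp
      qed
      have "(f has_integral (\<Sum>i<n. integral {y i..y (Suc i)} f)) {y 0..y n}"
        using has_integral_consecutive_intervals[of n y f] nodes(3) h f_int by auto
      then have "integral {a..b} f = (\<Sum>i<n. integral {y i..y (Suc i)} f)"
        using assms(2,3) by (simp add: y_def integral_unique)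
      also have "\<dots> = (\<Sum>i<n. h / 15 * W i - h\<^sup>2 / 15 * (f' (y (Suc i)) - f' (y i))
          + integral {y i..y i + 2 * h} (\<lambda>t. K i t * g i 6 t))"
        using panel_integral nodes(3) by (intro sum.cong) auto
      also have "\<dots> = h / 15 * (\<Sum>i<n. W i) - h\<^sup>2 / 15 * (\<Sum>i<n. f' (y (Suc i)) - f' (y i))
          + Rbar6 x h n f"
        by (simp only: R sum.distrib sum_subtractf sum_distrib_left[symmetric])
      also have "(\<Sum>i<n. f' (y (Suc i)) - f' (y i)) = f' b - f' a"
        using sum_lessThan_telescope[of "\<lambda>i. f' (y i)" n] assms(2,3) by (simp add: y_def)
      also have "(\<Sum>i<n. W i) = (\<Sum>j\<in>odds n. 7 * f (x (j - 1)) + 16 * f (x j) + 7 * f (x (j + 1)))"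
        unfolding sum_odds by (rule sum.cong) (use nodes in \<open>auto simp: W_def y_def\<close>)
      finally show ?thesis
        unfolding f'_def .
    qed
    show ?thesis
      using bound integrable quadrature by blast
  qed
qed

end
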